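(* Let $d<0$ be a square-free integer and suppose $\mathcal O_d$ is a principal ideal domain. Let $(A=\mathbb C^2/L,\ H=R+iQ)$ be a principally polarized abelian surface which admits an anti-holomorphic multiplication $\kappa:\mathbb C^2\to\mathbb C^2$ by $\mathcal O_d$. Then there exists a basis for the holomorphic 1-forms on $A$ and a symplectic basis for the lattice $L$ such that the resulting period matrix is $(Z,I)$ for some $Z\in\phi(\mathbf H_3)\subset\mathfrak h_2$, and such that the matrix for $\kappa$ with respect to this basis of $L$ is ${}^tN_\beta$.
   Context: Transpose is written ${}^tA$. $\mathcal O_d$ is the ring of integers of $\mathbb Q(\sqrt d)$. If $d\not\equiv1\pmod4$ put $\beta=\begin{pmatrix}0&1\\ d&0\end{pmatrix}$, $\sigma=I_2$. If $d=4m+1$ put $\beta=\begin{pmatrix}1&2\\ 2m&-1\end{pmatrix}$, $\sigma=\begin{pmatrix}2&0\\ -1&1\end{pmatrix}$. Put $N_\beta=\begin{pmatrix}\beta&0\\ 0&{}^t\beta\end{pmatrix}$. $\mathfrak h_2$ is the set of symmetric $2\times2$ complex matrices with positive definite imaginary part. $\mathbf H_3=\{(z,r)\in\mathbb C\times\mathbb R:\mathrm{Im}(z)>0\}$ and $\phi(z,r)=\sigma\begin{pmatrix}z&r\\ r&d\bar z\end{pmatrix}{}^t\sigma\in\mathfrak h_2$. A principally polarized abelian surface is a pair $(A=\mathbb C^2/L,\ H=R+iQ)$ with $H$ a positive definite Hermitian form on $\mathbb C^2$ ($R,Q$ its real and imaginary parts, $R(u,v)=Q(iu,v)$) and $L$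 a lattice admitting a symplectic $\mathbb Z$-basis, i.e. one in which $Q$ has matrix $\begin{pmatrix}0&I\\ -I&0\end{pmatrix}$. An anti-holomorphic multiplication by $\mathcal O_d$ is a complex anti-linear $\kappa:\mathbb C^2\to\mathbb C^2$ (the action of $\sqrt d$) with $\kappa^2=dI$; $Q(\kappa u,\kappa v)=d\,Q(u,v)$ for all $u,v\in\mathbb C^2$; $\kappa(L)\subset L$; and, if $d\equiv1\pmod4$, $\frac12(\kappa+I)(L)\subset L$. For a basis $\omega_1,\omega_2$ of holomorphic 1-forms and a $\mathbb Z$-basis $v_1,\dots,v_4$ of $L$, the period matrix is the $2\times4$ matrix with entries $\Omega_{ij}=\int_{v_j}\omega_i$. The matrix of $\kappa$ in a basis of $L$ has as its columns the coordinates of the images of the basis vectors. *)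

theory Defs
  imports "HOL-Analysis.Analysis" "HOL-Computational_Algebra.Squarefree"
    "HOL-Algebra.Ring_Divisibility"
begin

definition quadratic_field :: "int \<Rightarrow> complex set" where
  "quadratic_field d = {a + b * csqrt (of_int d) | a b. a \<in> \<rat> \<and> b \<in> \<rat>}"

definition ring_of_integers :: "int \<Rightarrow> complex ring" where
  "ring_of_integers d =
     \<lparr>carrier = {x \<in> quadratic_field d. algebraic_int x},
      monoid.mult = (*), one = 1, zero = 0, add = (+)\<rparr>"

definition hcat :: "'a^'m^'k \<Rightarrow> 'a^'n^'k \<Rightarrow> 'a^('m + 'n)^'k" where
  "hcat A B = (\<chi> i j. case j of Inl k \<Rightarrow> A $ i $ k | Inr k \<Rightarrow> B $ i $ k)"

definition vcat :: "'a^'k^'m \<Rightarrow> 'a^'k^'n \<Rightarrow> 'a^'k^('m + 'n)" where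
  "vcat A B = (\<chi> i. case i of Inl k \<Rightarrow> A $ k | Inr k \<Rightarrow> B $ k)"

text \<open>The type \<^typ>\<open>2 + 2\<close> has four elements: a \<open>\<int>\<close>-basis \<open>v\<^sub>1, \<dots>, v\<^sub>4\<close>
  is \<open>v (Inl 1), v (Inl 2), v (Inr 1), v (Inr 2)\<close>.\<close>

definition symplectic_matrix :: "int^(2 + 2)^(2 + 2)" where
  "symplectic_matrix = vcat (hcat 0 (mat 1)) (hcat (- mat 1) 0)"

definition beta_mat :: "int \<Rightarrow> int^2^2" where
  "beta_mat d =
     (if d mod 4 = 1 then vector [vector [1, 2], vector [2 * ((d - 1) div 4), -1]]
      else vector [vector [0, 1], vector [d, 0]])"

definition sigma_mat :: "int \<Rightarrow> int^2^2" where
  "sigma_mat d =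
     (if d mod 4 = 1 then vector [vector [2, 0], vector [-1, 1]] else mat 1)"

definition N_beta :: "int \<Rightarrow> int^(2 + 2)^(2 + 2)" where
  "N_beta d = vcat (hcat (beta_mat d) 0) (hcat 0 (transpose (beta_mat d)))"

definition siegel_space :: "(complex^2^2) set" where
  "siegel_space =
     {Z. transpose Z = Z \<and>
         (\<forall>x :: real^2. x \<noteq> 0 \<longrightarrow> x \<bullet> (map_matrix Im Z *v x) > 0)}"

definition H3 :: "(complex \<times> real) set" where
  "H3 = {(z, r). Im z > 0}"

definition phi :: "int \<Rightarrow> complex \<times> real \<Rightarrow> complex^2^2" where
  "phi d = (\<lambda>(z, r).
     let \<sigma> = map_matrix of_int (sigma_mat d) in
     \<sigma> ** vector [vector [z, of_real r], vector [of_real r, of_int d * cnj z]] ** transpose \<sigma>)"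

text \<open>\<^const>\<open>span\<close> is the real span, so \<open>L\<close> has full rank.\<close>

definition is_lattice :: "(complex^2) set \<Rightarrow> bool" where
  "is_lattice L \<longleftrightarrow>
     0 \<in> L \<and> (\<forall>u\<in>L. \<forall>v\<in>L. u - v \<in> L) \<and> discrete L \<and> span L = UNIV"

definition int_comb :: "('n::finite \<Rightarrow> complex^2) \<Rightarrow> int^'n \<Rightarrow> complex^2" where
  "int_comb v n = (\<Sum>j\<in>UNIV. of_int (n $ j) *\<^sub>R v j)"

definition Z_basis :: "(complex^2) set \<Rightarrow> ('n::finite \<Rightarrow> complex^2) \<Rightarrow> bool" where
  "Z_basis L v \<longleftrightarrow> bij_betw (int_comb v) UNIV L"

text \<open>The relation \<open>R(u,v) = Q(iu,v)\<close> between \<open>R = Re H\<close> and \<open>Q = Im H\<close> says that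
  \<open>H\<close> is complex linear in its first argument, and hence antilinear in the second.\<close>

definition pos_def_hermitian :: "(complex^2 \<Rightarrow> complex^2 \<Rightarrow> complex) \<Rightarrow> bool" where
  "pos_def_hermitian H \<longleftrightarrow>
     (\<forall>v. Vector_Spaces.linear (*s) (*) (\<lambda>u. H u v)) \<and>
     (\<forall>u v. H v u = cnj (H u v)) \<and>
     (\<forall>u. u \<noteq> 0 \<longrightarrow> Re (H u u) > 0)"

definition symplectic_basis ::
    "(complex^2) set \<Rightarrow> (complex^2 \<Rightarrow> complex^2 \<Rightarrow> complex) \<Rightarrow> (2 + 2 \<Rightarrow> complex^2) \<Rightarrow> bool" where
  "symplectic_basis L H v \<longleftrightarrow>
     Z_basis L v \<and> (\<forall>j k. Im (H (v j) (v k)) = of_int (symplectic_matrix $ j $ k))"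

definition pp_abelian_surface ::
    "(complex^2) set \<Rightarrow> (complex^2 \<Rightarrow> complex^2 \<Rightarrow> complex) \<Rightarrow> bool" where
  "pp_abelian_surface L H \<longleftrightarrow>
     is_lattice L \<and> pos_def_hermitian H \<and> (\<exists>v. symplectic_basis L H v)"

definition antilinear :: "(complex^2 \<Rightarrow> complex^2) \<Rightarrow> bool" where
  "antilinear f \<longleftrightarrow> (\<forall>u v. f (u + v) = f u + f v) \<and> (\<forall>c u. f (c *s u) = cnj c *s f u)"

definition antiholomorphic_multiplication ::
    "int \<Rightarrow> (complex^2) set \<Rightarrow> (complex^2 \<Rightarrow> complex^2 \<Rightarrow> complex)
     \<Rightarrow> (complex^2 \<Rightarrow> complex^2) \<Rightarrow> bool" where
  "antiholomorphic_multiplication d L H \<kappa> \<longleftrightarrow>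
     antilinear \<kappa> \<and>
     (\<forall>u. \<kappa> (\<kappa> u) = of_int d *s u) \<and>
     (\<forall>u v. Im (H (\<kappa> u) (\<kappa> v)) = of_int d * Im (H u v)) \<and>
     \<kappa> ` L \<subseteq> L \<and>
     (d mod 4 = 1 \<longrightarrow> (\<lambda>u. (1/2) *s (\<kappa> u + u)) ` L \<subseteq> L)"

text \<open>The columns of \<open>M\<close> are the coordinates of the images of the basis vectors.\<close>

definition has_matrix ::
    "('n::finite \<Rightarrow> complex^2) \<Rightarrow> (complex^2 \<Rightarrow> complex^2) \<Rightarrow> int^'n^'n \<Rightarrow> bool" where
  "has_matrix v f M \<longleftrightarrow> (\<forall>j. f (v j) = int_comb v (column j M))"

text \<open>A holomorphic 1-form on \<open>\<complex>\<^sup>2/L\<close> is given by its pullback to \<open>\<complex>\<^sup>2\<close>, an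
  \<open>L\<close>-invariant holomorphic 1-form; \<open>\<omega> z v\<close> is its value at the point \<open>z\<close> on the
  tangent vector \<open>v\<close>.\<close>

type_synonym form = "complex^2 \<Rightarrow> complex^2 \<Rightarrow> complex"

definition holomorphic_C2 :: "(complex^2 \<Rightarrow> complex) \<Rightarrow> bool" where
  "holomorphic_C2 f \<longleftrightarrow>
     (\<forall>z. \<exists>D. (f has_derivative D) (at z) \<and> Vector_Spaces.linear (*s) (*) D)"

definition holomorphic_1_forms :: "(complex^2) set \<Rightarrow> form set" where
  "holomorphic_1_forms L =
     {\<omega>. (\<forall>z. Vector_Spaces.linear (*s) (*) (\<omega> z)) \<and>
         (\<forall>v. holomorphic_C2 (\<lambda>z. \<omega> z v)) \<and>
         (\<forall>l\<in>L. \<forall>z. \<omega> (z + l) = \<omega> z)}"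

definition basis_of_1_forms :: "(complex^2) set \<Rightarrow> (2 \<Rightarrow> form) \<Rightarrow> bool" where
  "basis_of_1_forms L \<omega> \<longleftrightarrow>
     (\<forall>i. \<omega> i \<in> holomorphic_1_forms L) \<and>
     (\<forall>\<eta> \<in> holomorphic_1_forms L.
        \<exists>!c :: complex^2. \<eta> = (\<lambda>z v. \<Sum>i\<in>UNIV. c $ i * \<omega> i z v))"

text \<open>A lattice vector \<open>l\<close> represents the class in \<open>H\<^sub>1(\<complex>\<^sup>2/L, \<int>)\<close> of the loop
  \<open>t \<mapsto> t l\<close>, \<open>0 \<le> t \<le> 1\<close>.\<close>

definition period :: "form \<Rightarrow> complex^2 \<Rightarrow> complex" where
  "period \<omega> l = integral {0..1} (\<lambda>t. \<omega> (t *\<^sub>R l) l)"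

definition period_matrix :: "(2 \<Rightarrow> form) \<Rightarrow> ('n::finite \<Rightarrow> complex^2) \<Rightarrow> complex^'n^2" where
  "period_matrix \<omega> v = (\<chi> i j. period (\<omega> i) (v j))"

end

(* Since kappa is self-adjoint for Q, letting sqrt d act as kappa makes C^2 a second complex vector
   space on which Q(u, kappa v) + sqrt d Q(u, v) is a bilinear alternating form; up to a factor 1 or 2
   it takes values in O_d on L.  For a lattice vector v the values against L form an ideal, hence
   (g), and v/g is again in L because L is self-dual under Q.  So there are p, q in L whose
   form value is 1, and p, q together with multiples by generators of O_d are a symplectic basis in
   which kappa has the required matrix.  The forms dual to v_3, v_4 are a basis of the holomorphic
   1-forms by Liouville; Riemann's relations and the matrix of kappa put the period matrix
   into phi(H_3). *)

theory Submission
  imports Defs "HOL-Complex_Analysis.Cauchy_Integral_Formula"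
begin

subsection \<open>The ring of integers of an imaginary quadratic field\<close>

text \<open>The hypothesis speaks of all algebraic integers in the field, whereas \<open>L\<close>
  is only known to be stable under \<open>\<kappa>\<close> and, for \<open>d mod 4 = 1\<close>,
  under half of \<open>\<kappa> + 1\<close>. The two meet only once O_d is known to be Z + Z
  \<open>omega d\<close>. The four basis vectors are p, x p, y q, q with x = (sqrt d - t)/s and y =
  (sqrt d + t)/s, where s is the factor 1 or 2 and t = s - 1. If the form has value s at (p, q),
  then Q(a p, b q) is the coefficient of sqrt d in s a b. So Q is 1 at (p, y q) and (x p, q), and 0
  at (p, q) and at (x p, y q), because x y = (d - t^2)/s^2 is rational. The same choice gives sqrt d
  p = t p + s (x p), the first row of \<open>beta_mat d\<close>. That these vectors generate
  \<open>L\<close> requires no index computation: coordinates in a symplectic family are, up to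
  sign, values of Q, and these are integers on \<open>L\<close>.\<close>

lemma map_poly_of_int_add:
  "map_poly of_int (p + q) = (map_poly of_int p + map_poly of_int q :: 'a :: ring_1 poly)"
  by (simp add: poly_eq_iff coeff_map_poly)

lemma map_poly_of_int_mult:
  "map_poly of_int (p * q) = (map_poly of_int p * map_poly of_int q :: 'a :: comm_ring_1 poly)"
  by (simp add: poly_eq_iff coeff_map_poly coeff_mult)

lemma map_poly_of_int_smult:
  "map_poly of_int (Polynomial.smult c p)
    = Polynomial.smult (of_int c) (map_poly of_int p :: 'a :: comm_ring_1 poly)"
  by (simp add: poly_eq_iff coeff_map_poly)

text \<open>Gauss's lemma: a primitive integral minimal polynomial divides the monic one over \<open>\<int>\<close>.\<close>

lemma lead_coeff_dvd_1_if_minimal: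
  fixes x :: "'a :: field_char_0" and f :: "int poly"
  assumes "algebraic_int x" and f: "poly (map_poly of_int f) x = 0" "content f = 1"
    and minimal: "\<And>r. \<lbrakk>r \<noteq> 0; Polynomial.degree r < Polynomial.degree f\<rbrakk>
      \<Longrightarrow> poly (map_poly of_int r) x \<noteq> 0"
  shows "is_unit (lead_coeff f)"
proof -
  obtain p where p: "poly (map_poly of_int p) x = 0" "lead_coeff p = 1"
    using assms(1) by (auto simp: algebraic_int_altdef_ipoly)
  have "f \<noteq> 0" using f(2) by auto
  \<comment> \<open>Pseudo-division replaces division over the rationals; the factor
    \<open>a\<close> is its denominator.\<close>
  obtain a q where a: "a \<noteq> 0" "Polynomial.smult a p = f * q + pseudo_mod p f"
    using pseudo_mod(1)[OF \<open>f \<noteq> 0\<close>] by blast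
  have "poly (map_poly of_int (Polynomial.smult a p)) x = 0"
    using p(1) by (simp add: map_poly_of_int_smult)
  then have "poly (map_poly of_int (pseudo_mod p f)) x = 0"
    using f(1) unfolding a(2) by (simp add: map_poly_of_int_add map_poly_of_int_mult)
  then have "pseudo_mod p f = 0"
    using minimal pseudo_mod(2)[OF \<open>f \<noteq> 0\<close>] by blast
  then have eq: "Polynomial.smult a p = f * q" using a(2) by simp
  have "content p dvd 1"
    using content_dvd_coeff[of p "Polynomial.degree p"] p(2) by simp
  then have "content p = 1" by (metis is_unit_content_iff)
  \<comment> \<open>Since \<open>p\<close> and \<open>f\<close> both have content 1,
    multiplicativity of the content forces \<open>a\<close> to divide all of \<open>q\<close>, so
    the denominator cancels.\<close>
  then have "\<bar>a\<bar> = content q"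
    using arg_cong[OF eq, of content] f(2) by (simp add: content_mult)
  then have "q = Polynomial.smult a (Polynomial.smult (sgn a) (primitive_part q))"
    using content_times_primitive_part[of q] by (simp add: abs_mult_sgn mult.commute flip: abs_sgn)
  then obtain q' where "q = Polynomial.smult a q'" by blast
  then have "Polynomial.smult a p = Polynomial.smult a (f * q')" using eq by simp
  then have "p = f * q'" using a(1) by (simp add: poly_eq_iff)
  then have "lead_coeff f * lead_coeff q' = 1"
    using p(2) by (simp add: lead_coeff_mult)
  then show ?thesis by (metis dvd_triv_left)
qed

text \<open>After cancelling \<open>gcd c e\<close>, the square of what is left of \<open>c\<close>
  is coprime to what is left of \<open>e\<close>, so it divides the square-free
  \<open>d\<close>.\<close>

lemma dvd_if_square_dvd_squarefree_mult:
  fixes c d e :: int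
  assumes "squarefree d" "c\<^sup>2 dvd d * e\<^sup>2" "c \<noteq> 0"
  shows "c dvd e"
proof -
  obtain c' e' where c': "c = gcd c e * c'" "e = gcd c e * e'" "Rings.coprime c' e'"
    using gcd_coprime_exists[of c e] \<open>c \<noteq> 0\<close> by (metis gcd_eq_0_iff mult.commute)
  have "(gcd c e)\<^sup>2 * c'\<^sup>2 dvd (gcd c e)\<^sup>2 * (d * e'\<^sup>2)"
    using assms(2) c'(1,2) by (metis mult.left_commute power_mult_distrib)
  then have "c'\<^sup>2 dvd d * e'\<^sup>2"
    using \<open>c \<noteq> 0\<close> by simp
  then have "c'\<^sup>2 dvd d"
    using c'(3) by (simp add: coprime_dvd_mult_left_iff)
  then have "is_unit c'" using assms(1) squarefreeD by blast
  then show ?thesis using c'(1) by (metis gcd_dvd2 mult_unit_dvd_iff)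
qed

text \<open>Squares are 0 or 1 mod 4. Here (t + u sqrt d)/2 has integral norm \<open>n\<close>, and
  the parities decide whether it lies in Z + Z \<open>omega d\<close>.\<close>

lemma square_parities:
  fixes d t u n :: int
  assumes "t\<^sup>2 - d * u\<^sup>2 = 4 * n" "d mod 4 \<noteq> 0"
  shows "even (t - u)" and "d mod 4 \<noteq> 1 \<Longrightarrow> even t \<and> even u"
proof -
  consider k l where "t = 2 * k" "u = 2 * l" | k l where "t = 2 * k + 1" "u = 2 * l"
    | k l where "t = 2 * k" "u = 2 * l + 1" | k l where "t = 2 * k + 1" "u = 2 * l + 1"
    by (meson evenE oddE)
  then have "even (t - u) \<and> (d mod 4 \<noteq> 1 \<longrightarrow> even t \<and> even u)"
  proof cases
    case 2
    then have "4 * (n - k\<^sup>2 - k + d * l\<^sup>2) = 1"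
      using assms(1) by (simp add: power2_eq_square algebra_simps)
    then show ?thesis by presburger
  next
    case 3
    then have "d = 4 * (k\<^sup>2 - n - d * (l\<^sup>2 + l))"
      using assms(1) by (simp add: power2_eq_square algebra_simps)
    then show ?thesis using assms(2) by presburger
  next
    case 4
    then have "d = 1 + 4 * (k\<^sup>2 + k - n - d * (l\<^sup>2 + l))"
      using assms(1) by (simp add: power2_eq_square algebra_simps)
    then have "d mod 4 = 1" by presburger
    then show ?thesis using 4 by simp
  qed auto
  then show "even (t - u)" and "d mod 4 \<noteq> 1 \<Longrightarrow> even t \<and> even u" by auto
qed

definition omega :: "int \<Rightarrow> complex" where
  "omega d = (if d mod 4 = 1 then (1 + csqrt (of_int d)) / 2 else csqrt (of_int d))"

lemma csqrt_of_neg_int: "d < 0 \<Longrightarrow> csqrt (of_int d) = \<i> * of_real (sqrt (- of_int d))"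
  by (simp add: csqrt_of_real_nonpos)

text \<open>The element is a root of the monic quadratic polynomial formed from its trace and
  norm.\<close>

lemma algebraic_int_omega_comb: "algebraic_int (of_int a + of_int b * omega d)"
proof (cases "d mod 4 = 1")
  case True
  define m where "m = d div 4"
  have d: "d = 4 * m + 1" using True unfolding m_def by presburger
  define x where "x = of_int a + of_int b * omega d"
  have "csqrt (of_int d) = 2 * omega d - 1"
    using True by (simp add: omega_def add_divide_distrib)
  then have "(2 * omega d - 1)\<^sup>2 = 4 * of_int m + 1"
    using power2_csqrt[of "of_int d"] d by simp
  then have "4 * (omega d)\<^sup>2 = 4 * (omega d + of_int m)"
    by (simp add: power2_eq_square algebra_simps)
  then have "(omega d)\<^sup>2 = omega d + of_int m"
    by (simp only: mult_cancel_left) simp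
  moreover have "poly [:of_int (a\<^sup>2 + a * b - m * b\<^sup>2), - of_int (2 * a + b), 1:] x
      = (of_int b)\<^sup>2 * ((omega d)\<^sup>2 - (omega d + of_int m))"
    unfolding x_def by (simp add: power2_eq_square algebra_simps)
  ultimately have "poly [:of_int (a\<^sup>2 + a * b - m * b\<^sup>2), - of_int (2 * a + b), 1:] x = 0"
    by simp
  then show ?thesis unfolding x_def[symmetric]
    by (rule algebraic_int.intros[rotated 2]) (auto simp: coeff_pCons split: nat.splits)
next
  case False
  define x where "x = of_int a + of_int b * omega d"
  have "(omega d)\<^sup>2 = of_int d"
    using False by (simp add: omega_def)
  moreover have "poly [:of_int (a\<^sup>2 - d * b\<^sup>2), - of_int (2 * a), 1:] x
      = (of_int b)\<^sup>2 * ((omega d)\<^sup>2 - of_int d)"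
    unfolding x_def by (simp add: power2_eq_square algebra_simps)
  ultimately have "poly [:of_int (a\<^sup>2 - d * b\<^sup>2), - of_int (2 * a), 1:] x = 0"
    by simp
  then show ?thesis unfolding x_def[symmetric]
    by (rule algebraic_int.intros[rotated 2]) (auto simp: coeff_pCons split: nat.splits)
qed

text \<open>Trace and norm of an algebraic integer are integers by Gauss's lemma; square-freeness of
  \<open>d\<close> then bounds the denominator by 2, and a parity count settles the rest.\<close>

lemma quadratic_field_algebraic_int:
  assumes "d < 0" "squarefree d" "x \<in> quadratic_field d" "algebraic_int x"
  shows "\<exists>a b. x = of_int a + of_int b * omega d"
proof -
  let ?s = "csqrt (of_int d)"
  obtain a1 a2 b1 b2 where "a2 > 0" "b2 > 0"
    and x0: "x = of_int a1 / of_int a2 + of_int b1 / of_int b2 * ?s"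
    using assms(3) unfolding quadratic_field_def by (auto elim!: Rats_cases')
  define A B c where "A = a1 * b2" and "B = b1 * a2" and "c = a2 * b2"
  have c: "c > 0" using \<open>a2 > 0\<close> \<open>b2 > 0\<close> by (simp add: c_def)
  have x: "x = (of_int A + of_int B * ?s) / of_int c"
    unfolding x0 A_def B_def c_def using \<open>a2 > 0\<close> \<open>b2 > 0\<close> by (simp add: field_simps)
  show ?thesis
  proof (cases "B = 0")
    case True
    then have "x \<in> \<rat>" using x by simp
    then have "x \<in> \<int>" using assms(4) rational_algebraic_int_is_int by blast
    then obtain k where "x = of_int k" by (auto elim: Ints_cases)
    then have "x = of_int k + of_int 0 * omega d" by simp
    then show ?thesis by blast
  next
    case False
    \<comment> \<open>This is \<open>c\<^sup>2\<close> times the minimal polynomial of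
      \<open>x\<close>, as \<open>x\<close> is irrational for nonzero \<open>B\<close>.\<close>
    define f0 where "f0 = [:A\<^sup>2 - d * B\<^sup>2, - 2 * A * c, c\<^sup>2:]"
    define f where "f = primitive_part f0"
    have "f0 \<noteq> 0" using c by (simp add: f0_def)
    have f0: "f0 = Polynomial.smult (content f0) f" by (simp add: f_def)
    have "content f0 \<noteq> 0" using \<open>f0 \<noteq> 0\<close> by simp
    have cx: "of_int c * x = of_int A + of_int B * ?s" using x c by simp
    have "poly (map_poly of_int f0) x = (of_int c * x)\<^sup>2 - 2 * of_int A * (of_int c * x)
        + (of_int A)\<^sup>2 - of_int d * (of_int B)\<^sup>2"
      unfolding f0_def using c by (simp add: map_poly_pCons power2_eq_square algebra_simps)
    also have "\<dots> = (of_int B)\<^sup>2 * (?s\<^sup>2 - of_int d)"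
      unfolding cx by (simp only: power2_eq_square ring_distribs) (simp add: algebra_simps)
    also have "\<dots> = 0" by simp
    finally have "poly (map_poly of_int f) x = 0"
      using \<open>content f0 \<noteq> 0\<close> by (subst (asm) f0) (simp add: map_poly_of_int_smult)
    moreover have "content f = 1" using \<open>f0 \<noteq> 0\<close> by (simp add: f_def)
    \<comment> \<open>A nonzero integral relation of degree at most 1 already fails in imaginary
      part or constant term: \<open>x\<close> is not real because \<open>d < 0\<close> and
      \<open>B\<close> is nonzero.\<close>
    moreover have "poly (map_poly of_int r) x \<noteq> 0"
      if "r \<noteq> 0" "Polynomial.degree r < Polynomial.degree f" for r
    proof
      assume 0: "poly (map_poly of_int r) x = 0"
      have "Polynomial.degree f = 2"
        using c by (simp add: f_def f0_def)
      then have "Polynomial.degree r \<le> 1" using that(2) by simp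
      then have "r = [:Polynomial.coeff r 0, Polynomial.coeff r 1:]"
        by (intro poly_eqI) (auto simp: coeff_pCons coeff_eq_0 split: nat.splits)
      then obtain u w where r: "r = [:u, w:]" by blast
      then have "of_int u + of_int w * x = 0"
        using 0 by (cases "w = 0") (auto simp: map_poly_pCons mult.commute)
      then have "Im (of_int u + of_int w * x) = 0" "Re (of_int u + of_int w * x) = 0"
        by auto
      moreover have "Im x \<noteq> 0"
        using arg_cong[OF cx, of Im] False assms(1)
        unfolding csqrt_of_neg_int[OF assms(1)] by auto
      ultimately have "w = 0" "u = 0" by auto
      then show False using r that(1) by simp
    qed
    ultimately have unit: "is_unit (lead_coeff f)"
      using assms(4) by (intro lead_coeff_dvd_1_if_minimal[of x])
    have "content f0 * lead_coeff f = c\<^sup>2"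
      using arg_cong[OF f0, of lead_coeff] c by (simp add: f0_def)
    then have g: "c\<^sup>2 dvd content f0"
      using unit by (metis dvd_mult_unit_iff dvd_refl)
    have "c\<^sup>2 dvd Polynomial.coeff f0 0" "c\<^sup>2 dvd Polynomial.coeff f0 1"
      using g content_dvd_coeff dvd_trans by blast+
    then have "c\<^sup>2 dvd A\<^sup>2 - d * B\<^sup>2" "c * c dvd c * (2 * A)"
      by (auto simp: f0_def power2_eq_square mult_ac)
    \<comment> \<open>\<open>T\<close> and \<open>N\<close> are the trace and the norm of
      \<open>x\<close>; below, \<open>U\<close> makes \<open>x\<close> equal to (T + U sqrt
      d)/2.\<close>
    then obtain N T where N: "A\<^sup>2 - d * B\<^sup>2 = c\<^sup>2 * N" and T: "2 * A = c * T"
      using c by (auto elim!: dvdE)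
    have "d * (2 * B)\<^sup>2 = (2 * A)\<^sup>2 - 4 * (c\<^sup>2 * N)"
      using N by (simp add: power2_eq_square algebra_simps)
    also have "\<dots> = c\<^sup>2 * (T\<^sup>2 - 4 * N)"
      unfolding T by (simp add: power2_eq_square algebra_simps)
    finally have eq: "d * (2 * B)\<^sup>2 = c\<^sup>2 * (T\<^sup>2 - 4 * N)" .
    then have "c dvd 2 * B"
      using dvd_if_square_dvd_squarefree_mult[OF assms(2)] c by (metis dvd_triv_left less_irrefl)
    then obtain U where U: "2 * B = c * U" by (auto elim: dvdE)
    have "c\<^sup>2 * (d * U\<^sup>2) = c\<^sup>2 * (T\<^sup>2 - 4 * N)"
      using eq unfolding U by (simp add: power2_eq_square algebra_simps)
    then have TU: "T\<^sup>2 - d * U\<^sup>2 = 4 * N" using c by simp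
    have "d mod 4 \<noteq> 0"
      using squarefreeD[OF assms(2), of 2] by auto
    note par = square_parities[OF TU this]
    have "of_int c * (2 * x) = 2 * (of_int c * x)" by simp
    also have "\<dots> = of_int (2 * A) + of_int (2 * B) * ?s"
      unfolding cx by (simp add: algebra_simps)
    also have "\<dots> = of_int c * (of_int T + of_int U * ?s)"
      unfolding T U by (simp add: algebra_simps)
    finally have "2 * x = of_int T + of_int U * ?s"
      using c by (simp only: mult_cancel_left) simp
    then have xTU: "x = (of_int T + of_int U * ?s) / 2" by (simp add: eq_divide_eq mult.commute)
    show ?thesis
    proof (cases "d mod 4 = 1")
      case True
      obtain k where "T - U = 2 * k" using par(1) by (rule evenE)
      then have "T = U + 2 * k" by simp
      then have "x = of_int k + of_int U * omega d"
        using True unfolding xTU by (simp add: omega_def field_simps)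
      then show ?thesis by blast
    next
      case False
      then obtain k l where "T = 2 * k" "U = 2 * l" using par(2) by (blast elim: evenE)
      then have "x = of_int k + of_int l * omega d"
        using False unfolding xTU by (simp add: omega_def field_simps)
      then show ?thesis by blast
    qed
  qed
qed

lemma omega_comb_in_quadratic_field: "of_int a + of_int b * omega d \<in> quadratic_field d"
proof (cases "d mod 4 = 1")
  case True
  have "of_int a + of_int b * omega d
      = (of_int a + of_int b / 2) + of_int b / 2 * csqrt (of_int d)"
    using True by (simp add: omega_def field_simps)
  moreover have "of_int a + of_int b / 2 \<in> (\<rat> :: complex set)" "of_int b / 2 \<in> (\<rat> :: complex set)"
    by auto
  ultimately show ?thesis unfolding quadratic_field_def by blast
next
  case False
  then have "of_int a + of_int b * omega d = of_int a + of_int b * csqrt (of_int d)"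
    by (simp add: omega_def)
  then show ?thesis unfolding quadratic_field_def using Rats_of_int by blast
qed

lemma carrier_ring_of_integers:
  assumes "d < 0" "squarefree d"
  shows "carrier (ring_of_integers d) = {of_int a + of_int b * omega d | a b. True}"
  using quadratic_field_algebraic_int[OF assms]
  by (auto simp: ring_of_integers_def algebraic_int_omega_comb omega_comb_in_quadratic_field)

subsection \<open>Lattices with multiplication by a quadratic order\<close>

text \<open>\<open>Q\<close> stands for the imaginary part of the Hermitian form. The setting is
  real because \<open>\<kappa>\<close> anticommutes with \<open>\<i>\<close>, so the structure in
  which it becomes a scalar is not the given one.\<close>

locale quadratic_action =
  fixes d :: int and \<kappa> :: "'a::real_vector \<Rightarrow> 'a" and Q :: "'a \<Rightarrow> 'a \<Rightarrow> real"
  assumes d_neg: "d < 0"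
    and linear_kappa: "linear \<kappa>"
    and kappa_kappa: "\<kappa> (\<kappa> u) = of_int d *\<^sub>R u"
    and bilinear_Q: "bilinear Q"
    and Q_kappa_kappa: "Q (\<kappa> u) (\<kappa> v) = of_int d * Q u v"
    and Q_skew: "Q u v = - Q v u"
begin

lemmas Q_simps = bilinear_ladd[OF bilinear_Q] bilinear_radd[OF bilinear_Q]
  bilinear_lmul[OF bilinear_Q] bilinear_rmul[OF bilinear_Q]
  bilinear_lsub[OF bilinear_Q] bilinear_rsub[OF bilinear_Q]
  bilinear_lneg[OF bilinear_Q] bilinear_rneg[OF bilinear_Q]
  bilinear_lzero[OF bilinear_Q] bilinear_rzero[OF bilinear_Q]

lemmas kappa_simps = linear_add[OF linear_kappa] linear_diff[OF linear_kappa]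
  linear_scale[OF linear_kappa] linear_0[OF linear_kappa] linear_neg[OF linear_kappa]

lemma Q_self: "Q u u = 0"
  using Q_skew[of u u] by simp

lemma Q_kappa_left: "Q (\<kappa> u) v = Q u (\<kappa> v)"
proof -
  have "of_int d * Q (\<kappa> u) v = Q (\<kappa> (\<kappa> u)) (\<kappa> v)"
    by (simp add: Q_kappa_kappa)
  also have "\<dots> = of_int d * Q u (\<kappa> v)"
    by (simp add: kappa_kappa Q_simps)
  finally show ?thesis using d_neg by simp
qed

text \<open>Skew-symmetry and self-adjointness of \<open>\<kappa>\<close> give opposite signs. With
  \<open>Q_self\<close>, the O_d-span of a single vector is isotropic for \<open>Q\<close>.\<close>

lemma Q_self_kappa: "Q u (\<kappa> u) = 0"
  using Q_skew[of u "\<kappa> u"] Q_kappa_left[of u u] by simp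

definition rootd :: real where "rootd = sqrt (- of_int d)"

lemma rootd_pos: "rootd > 0" and rootd_square: "rootd * rootd = - of_int d"
  using d_neg by (auto simp: rootd_def)

lemma csqrt_d: "csqrt (of_int d) = Complex 0 rootd"
  unfolding csqrt_of_neg_int[OF d_neg] rootd_def by (simp add: complex_eq_iff)

lemma rootd_square': "rootd * (rootd * x) = - (of_int d * x)"
  using rootd_square by (metis mult.assoc mult_minus_left)

text \<open>Scalar multiplication for the second complex structure; the division by
  \<open>rootd\<close> makes \<open>csqrt (of_int d)\<close> act as \<open>\<kappa>\<close>.\<close>

definition act :: "complex \<Rightarrow> 'a \<Rightarrow> 'a" where
  "act x u = Re x *\<^sub>R u + (Im x / rootd) *\<^sub>R \<kappa> u"

text \<open>The only form that is complex bilinear for \<open>act\<close> and has imaginary part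
  \<open>rootd\<close> times \<open>Q\<close>.\<close>

definition pairing :: "'a \<Rightarrow> 'a \<Rightarrow> complex" where
  "pairing u v = Complex (Q u (\<kappa> v)) (rootd * Q u v)"

lemma pairing_act_left: "pairing (act x u) v = x * pairing u v"
  using rootd_pos
  by (simp add: rootd_square' pairing_def act_def Q_simps Q_kappa_left kappa_kappa complex_eq_iff field_simps)

lemma pairing_act_right: "pairing u (act x v) = x * pairing u v"
  using rootd_pos
  by (simp add: rootd_square' pairing_def act_def Q_simps kappa_simps kappa_kappa complex_eq_iff field_simps)

lemma pairing_add: "pairing u (v + w) = pairing u v + pairing u w"
  and pairing_minus: "pairing u (- v) = - pairing u v"
  by (simp_all add: pairing_def Q_simps kappa_simps complex_eq_iff algebra_simps)

end

text \<open>\<open>self_dual\<close> is the unimodularity of the principal polarization, in the form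
  that puts a newly built vector into \<open>L\<close>.\<close>

locale quadratic_lattice = quadratic_action +
  fixes L :: "'a set"
  assumes zero_in_L: "0 \<in> L"
    and diff_in_L: "\<lbrakk>u \<in> L; v \<in> L\<rbrakk> \<Longrightarrow> u - v \<in> L"
    and kappa_in_L: "u \<in> L \<Longrightarrow> \<kappa> u \<in> L"
    and half_in_L: "\<lbrakk>d mod 4 = 1; u \<in> L\<rbrakk> \<Longrightarrow> (1/2) *\<^sub>R (\<kappa> u + u) \<in> L"
    and Q_int: "\<lbrakk>u \<in> L; v \<in> L\<rbrakk> \<Longrightarrow> Q u v \<in> \<int>"
    and self_dual: "(\<And>v. v \<in> L \<Longrightarrow> Q u v \<in> \<int>) \<Longrightarrow> u \<in> L"
begin

lemma neg_in_L: "u \<in> L \<Longrightarrow> - u \<in> L"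
  using diff_in_L[OF zero_in_L] by simp

lemma add_in_L: "\<lbrakk>u \<in> L; v \<in> L\<rbrakk> \<Longrightarrow> u + v \<in> L"
  using diff_in_L[of u "- v"] neg_in_L by simp

lemma of_int_scale_in_L: "u \<in> L \<Longrightarrow> of_int n *\<^sub>R u \<in> L"
proof (induction n rule: int_induct[where k = 0])
  case (step1 i)
  then show ?case by (simp add: scaleR_add_left add_in_L)
next
  case (step2 i)
  then show ?case by (simp add: scaleR_diff_left diff_in_L)
qed (simp add: zero_in_L)

lemma omega_eq: "omega d = (if d mod 4 = 1 then Complex (1/2) (rootd / 2) else Complex 0 rootd)"
  by (simp add: omega_def csqrt_d complex_eq_iff)

lemma act_in_L:
  assumes "u \<in> L"
  shows "act (of_int a + of_int b * omega d) u \<in> L"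
proof -
  have "act (omega d) u \<in> L"
    using half_in_L[OF _ assms] kappa_in_L[OF assms] rootd_pos
    by (auto simp: act_def omega_eq algebra_simps)
  moreover have "act (of_int a + of_int b * omega d) u = of_int a *\<^sub>R u + of_int b *\<^sub>R act (omega d) u"
    by (simp add: act_def algebra_simps add_divide_distrib)
  ultimately show ?thesis
    by (simp add: assms add_in_L of_int_scale_in_L)
qed

text \<open>For \<open>d mod 4 = 1\<close> the integers \<open>Q u (\<kappa> v)\<close> and
  \<open>Q u v\<close> have equal parity on \<open>L\<close>, so \<open>pairing u v\<close> is twice
  an element of Z + Z \<open>omega d\<close>.\<close>

definition scale :: real where "scale = (if d mod 4 = 1 then 2 else 1)"

lemma scale_pos: "scale > 0" by (simp add: scale_def)

lemma pairing_in_omega_lattice: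
  assumes "u \<in> L" "v \<in> L"
  shows "\<exists>a b. pairing u v / scale = of_int a + of_int b * omega d"
proof -
  obtain b where b: "Q u v = of_int b" using Q_int[OF assms] by (auto elim: Ints_cases)
  show ?thesis
  proof (cases "d mod 4 = 1")
    case True
    \<comment> \<open>Half of \<open>\<kappa> v - v\<close>: its \<open>Q\<close>-value is the
      coefficient \<open>a\<close>, because 2 (a + b omega) = (2 a + b) + b sqrt d.\<close>
    have "(1/2) *\<^sub>R (\<kappa> v + v) - v \<in> L"
      using half_in_L[OF True] assms diff_in_L by blast
    then have "Q u ((1/2) *\<^sub>R (\<kappa> v + v) - v) \<in> \<int>" by (rule Q_int[OF assms(1)])
    then obtain a where "Q u ((1/2) *\<^sub>R (\<kappa> v + v) - v) = of_int a" by (auto elim: Ints_cases)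
    then have "pairing u v / scale = of_int a + of_int b * omega d"
      using True b by (simp add: pairing_def Q_simps scale_def omega_eq complex_eq_iff field_simps)
    then show ?thesis by blast
  next
    case False
    obtain a where "Q u (\<kappa> v) = of_int a"
      using Q_int[OF assms(1) kappa_in_L[OF assms(2)]] by (auto elim: Ints_cases)
    then have "pairing u v / scale = of_int a + of_int b * omega d"
      using False b by (simp add: pairing_def scale_def omega_eq complex_eq_iff)
    then show ?thesis by blast
  qed
qed

text \<open>The ideal of all values of the pairing against a fixed lattice vector has a generator;
  dividing the vector by it stays inside the lattice because the lattice is self-dual.\<close>

lemma exists_normalized_pair:
  assumes "squarefree d" "principal_domain (ring_of_integers d)"
    and nonzero: "v \<in> L" "w \<in> L" "Q v w \<noteq> 0"
  shows "\<exists>p\<in>L. \<exists>q\<in>L. Q p q = 0 \<and> Q p (\<kappa> q) = scale"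
proof -
  define R where "R = ring_of_integers d"
  interpret R: principal_domain R using assms(2) by (simp add: R_def)
  have carrier: "carrier R = {of_int a + of_int b * omega d | a b. True}"
    unfolding R_def by (rule carrier_ring_of_integers[OF d_neg assms(1)])
  have ops: "mult R = (*)" "one R = 1" "zero R = 0" "add R = (+)"
    by (simp_all add: R_def ring_of_integers_def)
  define I where "I = (\<lambda>l. pairing v l / scale) ` L"
  have "ideal I R"
  proof (rule idealI)
    have sub: "I \<subseteq> carrier R"
      using pairing_in_omega_lattice[OF nonzero(1)] unfolding I_def carrier by blast
    show "subgroup I (add_monoid R)"
    proof (rule R.add.subgroupI)
      show "I \<noteq> {}" using nonzero(1) by (auto simp: I_def)
    next
      fix x assume "x \<in> I"
      then obtain l where l: "l \<in> L" "x = pairing v l / scale" by (auto simp: I_def)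
      then have "- x = pairing v (- l) / scale" by (simp add: pairing_minus)
      then have "- x \<in> I" using neg_in_L[OF l(1)] by (auto simp: I_def)
      moreover have "\<ominus>\<^bsub>R\<^esub> x = - x"
      proof (rule R.minus_equality)
        show "- x \<oplus>\<^bsub>R\<^esub> x = \<zero>\<^bsub>R\<^esub>" by (simp add: ops)
      qed (use sub \<open>- x \<in> I\<close> \<open>x \<in> I\<close> in auto)
      ultimately show "\<ominus>\<^bsub>R\<^esub> x \<in> I" by simp
    next
      fix x y assume "x \<in> I" "y \<in> I"
      then obtain l k where "l \<in> L" "k \<in> L" "x = pairing v l / scale" "y = pairing v k / scale"
        by (auto simp: I_def)
      then have "x + y = pairing v (l + k) / scale" "l + k \<in> L"
        by (simp_all add: pairing_add add_divide_distrib add_in_L)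
      then show "x \<oplus>\<^bsub>R\<^esub> y \<in> I" by (auto simp: I_def ops)
    qed (rule sub)
    have mult: "x * y \<in> I" if y: "y \<in> I" and x: "x \<in> carrier R" for x y
    proof -
      obtain l where "l \<in> L" "y = pairing v l / scale" using y by (auto simp: I_def)
      moreover from this have "act x l \<in> L" using act_in_L x by (auto simp: carrier)
      ultimately show ?thesis
        by (auto simp: I_def pairing_act_right intro!: image_eqI[of _ _ "act x l"])
    qed
    show "x \<otimes>\<^bsub>R\<^esub> y \<in> I" "y \<otimes>\<^bsub>R\<^esub> x \<in> I" if "y \<in> I" "x \<in> carrier R" for x y
      using mult[OF that] by (simp_all add: ops mult.commute)
  qed (rule R.ring_axioms)
  then obtain g where g: "g \<in> carrier R" "I = PIdl\<^bsub>R\<^esub> g" using R.exists_gen by blast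
  then have I: "I = {x * g | x. x \<in> carrier R}" by (simp add: cgenideal_def ops)
  have "pairing v w / scale \<in> I" using nonzero(2) unfolding I_def by (rule imageI)
  moreover have "pairing v w / scale \<noteq> 0"
    using nonzero(3) rootd_pos scale_pos by (simp add: pairing_def complex_eq_iff)
  ultimately have "g \<noteq> 0" by (auto simp: I)
  define p where "p = act (1 / g) v"
  have pairing_p: "pairing p l = pairing v l / g" for l
    by (simp add: p_def pairing_act_left)
  have "p \<in> L"
  proof (rule self_dual)
    fix l assume "l \<in> L"
    then have "pairing v l / scale \<in> I" unfolding I_def by (rule imageI)
    then obtain a b where "pairing v l / scale = (of_int a + of_int b * omega d) * g"
      by (auto simp: I carrier)
    then have "pairing p l = scale * (of_int a + of_int b * omega d)"
      using \<open>g \<noteq> 0\<close> scale_pos by (simp add: pairing_p field_simps)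
    \<comment> \<open>Comparison of imaginary parts: \<open>scale * omega d\<close> has imaginary
      part \<open>rootd\<close> in both residue cases.\<close>
    then have "rootd * Q p l = rootd * of_int b"
      by (auto simp: pairing_def omega_eq scale_def complex_eq_iff split: if_splits)
    then show "Q p l \<in> \<int>" using rootd_pos by simp
  qed
  \<comment> \<open>The generator is itself a value of the form at \<open>v\<close>; dividing
    \<open>v\<close> by \<open>g\<close> turns that value into \<open>scale\<close>.\<close>
  have "g \<in> I"
    using R.one_closed by (auto simp: I ops intro!: exI[of _ 1])
  then obtain q where "q \<in> L" "pairing v q / scale = g" by (auto simp: I_def)
  then have "pairing p q = scale"
    using \<open>g \<noteq> 0\<close> scale_pos by (simp add: pairing_p field_simps)
  then have "Q p q = 0" "Q p (\<kappa> q) = scale"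
    using rootd_pos by (auto simp: pairing_def complex_eq_iff)
  with \<open>p \<in> L\<close> \<open>q \<in> L\<close> show ?thesis by blast
qed

end

subsection \<open>Symplectic frames\<close>

lemma one_neq_two_in_2 [simp]: "(1::2) \<noteq> 2" "(2::2) \<noteq> 1"
  by simp_all

lemma sum_2_plus_2: "sum f (UNIV :: (2 + 2) set) = f (Inl 1) + f (Inl 2) + f (Inr 1) + f (Inr 2)"
  for f :: "2 + 2 \<Rightarrow> 'b::comm_monoid_add"
proof -
  have "(UNIV :: (2 + 2) set) = {Inl 1, Inl 2, Inr 1, Inr 2}"
    by (auto simp: UNIV_sum UNIV_2)
  from arg_cong[OF this, of "sum f"] show ?thesis by (simp add: add.assoc)
qed

lemma forall_2_plus_2: "(\<forall>j :: 2 + 2. P j) \<longleftrightarrow> P (Inl 1) \<and> P (Inl 2) \<and> P (Inr 1) \<and> P (Inr 2)"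
  by (simp add: split_sum_all forall_2)

lemma hcat_nth [simp]: "hcat A B $ i $ Inl k = A $ i $ k" "hcat A B $ i $ Inr l = B $ i $ l"
  and vcat_nth [simp]: "vcat C D $ Inl m = C $ m" "vcat C D $ Inr n = D $ n"
  by (simp_all add: hcat_def vcat_def)

lemma symplectic_matrix_nth [simp]:
  "symplectic_matrix $ Inl i $ Inl j = 0" "symplectic_matrix $ Inr i $ Inr j = 0"
  "symplectic_matrix $ Inl i $ Inr j = (if i = j then 1 else 0)"
  "symplectic_matrix $ Inr i $ Inl j = (if i = j then - 1 else 0)"
  by (simp_all add: symplectic_matrix_def mat_def)

text \<open>The map \<open>c\<close> of \<open>Q\<close>-values has the right inverse
  \<open>e\<close>; equality of dimensions makes \<open>c\<close> injective, so \<open>e\<close> is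
  also a left inverse. In particular the family spans.\<close>

lemma symplectic_expansion:
  fixes Q :: "'a::euclidean_space \<Rightarrow> 'a \<Rightarrow> real" and v :: "2 + 2 \<Rightarrow> 'a"
  assumes "DIM('a) = 4" and "bilinear Q"
    and symp: "\<And>j k. Q (v j) (v k) = of_int (symplectic_matrix $ j $ k)"
  shows "w = Q w (v (Inr 1)) *\<^sub>R v (Inl 1) + Q w (v (Inr 2)) *\<^sub>R v (Inl 2)
    - Q w (v (Inl 1)) *\<^sub>R v (Inr 1) - Q w (v (Inl 2)) *\<^sub>R v (Inr 2)"
proof -
  note Q_simps = bilinear_ladd[OF \<open>bilinear Q\<close>] bilinear_lmul[OF \<open>bilinear Q\<close>]
    bilinear_lsub[OF \<open>bilinear Q\<close>]
  define c where "c w = (\<chi> j. Q w (v j))" for w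
  define e where "e y = y $ Inr 1 *\<^sub>R v (Inl 1) + y $ Inr 2 *\<^sub>R v (Inl 2)
    - y $ Inl 1 *\<^sub>R v (Inr 1) - y $ Inl 2 *\<^sub>R v (Inr 2)" for y :: "real^(2+2)"
  have "linear c"
    by (rule linearI) (simp_all add: c_def Q_simps vec_eq_iff)
  have ce: "c (e y) = y" for y
    by (simp add: c_def e_def Q_simps vec_eq_iff forall_2_plus_2 symp)
  then have "surj c" by (metis surjI)
  then have "inj c"
    using \<open>linear c\<close> by (intro linear_surjective_imp_injective) (simp_all add: assms(1))
  then have "e (c w) = w" using ce by (metis injD)
  then show ?thesis by (simp add: e_def c_def)
qed

lemma scaleR_eq_vector_smult: "r *\<^sub>R u = of_real r *s u" for u :: "complex^'n"
  unfolding vec_eq_iff by (simp add: scaleR_conv_of_real[where 'a = complex])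

lemma int_comb_2_plus_2:
  "int_comb v n = of_int (n $ Inl 1) *\<^sub>R v (Inl 1) + of_int (n $ Inl 2) *\<^sub>R v (Inl 2)
    + of_int (n $ Inr 1) *\<^sub>R v (Inr 1) + of_int (n $ Inr 2) *\<^sub>R v (Inr 2)"
  for v :: "2 + 2 \<Rightarrow> complex^2"
  by (simp add: int_comb_def sum_2_plus_2)

lemma Z_basis_mem: "Z_basis L v \<Longrightarrow> v j \<in> L"
proof -
  assume "Z_basis L v"
  then have "int_comb v (axis j 1) \<in> L"
    unfolding Z_basis_def bij_betw_def by blast
  moreover have "int_comb v (axis j 1) = (\<Sum>i\<in>UNIV. if i = j then v i else 0)"
    unfolding int_comb_def by (rule sum.cong) (auto simp: axis_def)
  ultimately show "v j \<in> L" by simp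
qed

locale hermitian =
  fixes H :: "complex^2 \<Rightarrow> complex^2 \<Rightarrow> complex"
  assumes pos_def_hermitian: "pos_def_hermitian H"
begin

lemma H_cnj: "H v u = cnj (H u v)"
  using pos_def_hermitian unfolding pos_def_hermitian_def by blast

lemma H_pos: "u \<noteq> 0 \<Longrightarrow> Re (H u u) > 0"
  using pos_def_hermitian unfolding pos_def_hermitian_def by blast

lemma H_add_left: "H (u + u') v = H u v + H u' v"
  and H_smult_left: "H (c *s u) v = c * H u v"
  using pos_def_hermitian unfolding pos_def_hermitian_def Vector_Spaces.linear_iff by blast+

lemma H_add_right: "H u (v + v') = H u v + H u v'"
  and H_smult_right: "H u (c *s v) = cnj c * H u v"
  by (simp_all only: H_cnj[of u "v + v'"] H_cnj[of u v] H_cnj[of u v'] H_cnj[of u "c *s v"]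
      H_add_left H_smult_left complex_cnj_add complex_cnj_mult)

lemmas H_simps = H_add_left H_smult_left H_add_right H_smult_right

lemma bilinear_Im_H: "bilinear (\<lambda>u v. Im (H u v))"
  unfolding bilinear_def by (auto intro!: linearI simp: H_simps scaleR_eq_vector_smult)

lemma Im_H_skew: "Im (H u v) = - Im (H v u)"
  using H_cnj[of u v] by simp

end

text \<open>No lattice is fixed, so that this covers both the basis given with the surface and a
  family whose integral span is still to be found.\<close>

locale symplectic_frame = hermitian +
  fixes v :: "2 + 2 \<Rightarrow> complex^2"
  assumes symplectic: "Im (H (v j) (v k)) = of_int (symplectic_matrix $ j $ k)"
begin

lemmas Im_H_simps = bilinear_ladd[OF bilinear_Im_H] bilinear_radd[OF bilinear_Im_H]
  bilinear_lmul[OF bilinear_Im_H] bilinear_rmul[OF bilinear_Im_H]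
  bilinear_lsub[OF bilinear_Im_H] bilinear_rsub[OF bilinear_Im_H]

lemma frame_expansion:
  "w = Im (H w (v (Inr 1))) *\<^sub>R v (Inl 1) + Im (H w (v (Inr 2))) *\<^sub>R v (Inl 2)
    - Im (H w (v (Inl 1))) *\<^sub>R v (Inr 1) - Im (H w (v (Inl 2))) *\<^sub>R v (Inr 2)"
  by (rule symplectic_expansion[OF _ bilinear_Im_H symplectic]) simp

lemma int_comb_inj: "inj (int_comb v)"
proof (rule injI)
  fix m n assume eq: "int_comb v m = int_comb v n"
  have "Im (H (int_comb v m) (v j)) = Im (H (int_comb v n) (v j))" for j
    by (simp add: eq)
  from this[of "Inl 1"] this[of "Inl 2"] this[of "Inr 1"] this[of "Inr 2"]
  show "m = n"
    by (simp add: int_comb_2_plus_2 Im_H_simps symplectic vec_eq_iff forall_2_plus_2)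
qed

text \<open>The symplectic matrix is unimodular: coordinates of \<open>w\<close> are its
  \<open>Q\<close>-values up to sign and order. This yields self-duality of \<open>L\<close> and
  later shows that a symplectic family in \<open>L\<close> generates it.\<close>

lemma int_comb_if_integral:
  assumes "\<And>j. Im (H w (v j)) \<in> \<int>"
  shows "w \<in> range (int_comb v)"
proof -
  have "\<forall>j. \<exists>m. Im (H w (v j)) = of_int m"
    using assms by (auto elim: Ints_cases)
  then obtain n where n: "\<And>j. Im (H w (v j)) = of_int (n j)"
    by metis
  have "w = int_comb v (\<chi> j. case j of Inl i \<Rightarrow> n (Inr i) | Inr i \<Rightarrow> - n (Inl i))"
    by (subst frame_expansion[of w]) (simp add: int_comb_2_plus_2 n)
  then show ?thesis by blast
qed

lemma symplectic_basis_iff: "symplectic_basis L H v \<longleftrightarrow> range (int_comb v) = L"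
  using int_comb_inj by (simp add: symplectic_basis_def Z_basis_def bij_betw_def symplectic)

definition frame_matrix :: "complex^2^2" where
  "frame_matrix = (\<chi> i j. v (Inr j) $ i)"

lemma frame_matrix_mult: "frame_matrix *v c = c $ 1 *s v (Inr 1) + c $ 2 *s v (Inr 2)"
  by (simp add: frame_matrix_def matrix_vector_mult_def sum_2 vec_eq_iff mult.commute)

lemma Im_H_i_self: "Im (H (\<i> *s y) y) = Re (H y y)"
  by (simp add: H_simps)

text \<open>The real span of \<open>v (Inr 1), v (Inr 2)\<close> is isotropic for the imaginary part of \<open>H\<close>, so
  by positivity it meets its multiple by \<open>\<i>\<close> only in \<open>0\<close>.\<close>

lemma frame_matrix_inj: "frame_matrix *v c = 0 \<Longrightarrow> c = 0"
proof -
  assume 0: "frame_matrix *v c = 0"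
  define x y where "x = Re (c $ 1) *\<^sub>R v (Inr 1) + Re (c $ 2) *\<^sub>R v (Inr 2)"
    and "y = Im (c $ 1) *\<^sub>R v (Inr 1) + Im (c $ 2) *\<^sub>R v (Inr 2)"
  have "frame_matrix *v c = x + \<i> *s y"
    by (simp add: frame_matrix_mult x_def y_def vec_eq_iff complex_eq_iff)
  then have "x + \<i> *s y = 0" using 0 by simp
  then have "Im (H (x + \<i> *s y) y) = 0"
    by (simp add: bilinear_lzero[OF bilinear_Im_H])
  moreover have "Im (H x y) = 0"
    by (simp add: x_def y_def Im_H_simps symplectic)
  ultimately have "Re (H y y) = 0"
    using Im_H_i_self[of y] by (simp add: H_add_left)
  then have "y = 0" using H_pos[of y] by fastforce
  then have "x = 0" using \<open>x + \<i> *s y = 0\<close> by simp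
  \<comment> \<open>\<open>Q\<close>-values against \<open>v (Inl i)\<close> read off the real and
    imaginary parts of \<open>c\<close>.\<close>
  have "Im (H x (v (Inl i))) = 0" "Im (H y (v (Inl i))) = 0" for i
    using \<open>x = 0\<close> \<open>y = 0\<close> by (simp_all add: bilinear_lzero[OF bilinear_Im_H])
  from this[of 1] this[of 2] show "c = 0"
    by (simp add: x_def y_def Im_H_simps symplectic vec_eq_iff forall_2 complex_eq_iff)
qed

lemma frame_matrix_cancel: "frame_matrix *v a = frame_matrix *v b \<Longrightarrow> a = b"
  using frame_matrix_inj[of "a - b"] by (simp add: matrix_vector_mult_diff_distrib)

text \<open>The inverse of \<open>frame_matrix\<close>; its rows are the linear forms dual to
  \<open>v (Inr 1)\<close>, \<open>v (Inr 2)\<close>.\<close>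

definition dual_matrix :: "complex^2^2" where
  "dual_matrix = (SOME B. B ** frame_matrix = mat 1)"

lemma dual_matrix_left: "dual_matrix *v (frame_matrix *v c) = c"
  and dual_matrix_right: "frame_matrix *v (dual_matrix *v c) = c"
proof -
  have "\<exists>B. B ** frame_matrix = mat 1"
    unfolding matrix_left_invertible_injective by (auto intro!: injI frame_matrix_cancel)
  then have left: "dual_matrix ** frame_matrix = mat 1"
    unfolding dual_matrix_def by (rule someI_ex)
  then have "frame_matrix ** dual_matrix = mat 1"
    by (rule matrix_left_right_inverse1)
  with left show "dual_matrix *v (frame_matrix *v c) = c" "frame_matrix *v (dual_matrix *v c) = c"
    by (simp_all add: matrix_vector_mul_assoc)
qed

lemma v_Inr: "v (Inr i) = frame_matrix *v axis i 1"
  using exhaust_2[of i] by (auto simp: frame_matrix_mult axis_def)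

end

subsection \<open>Holomorphic forms on a complex torus\<close>

text \<open>Taking fractional parts of coordinates moves every point into the fundamental
  parallelepiped, a compact image of the unit cube.\<close>

lemma bounded_if_lattice_periodic:
  fixes f :: "'a::real_normed_vector \<Rightarrow> 'b::real_normed_vector" and v :: "'n::finite \<Rightarrow> 'a"
  assumes "continuous_on UNIV f"
    and span: "\<And>z. \<exists>x. z = (\<Sum>j\<in>UNIV. x j *\<^sub>R v j)"
    and periodic: "\<And>z n. f (z + (\<Sum>j\<in>UNIV. of_int (n j) *\<^sub>R v j)) = f z"
  shows "bounded (range f)"
proof -
  define g where "g x = (\<Sum>j\<in>UNIV. x $ j *\<^sub>R v j)" for x :: "real^'n"
  have "continuous_on (cbox 0 1) g"
    unfolding g_def by (intro continuous_intros)
  then have "compact (f ` g ` cbox 0 1)"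
    using assms(1) by (intro compact_continuous_image) (auto intro: continuous_on_subset)
  moreover have "range f \<subseteq> f ` g ` cbox 0 1"
  proof
    fix w assume "w \<in> range f"
    then obtain z where z: "w = f z" by blast
    obtain x where x: "z = (\<Sum>j\<in>UNIV. x j *\<^sub>R v j)" using span by blast
    define y :: "real^'n" where "y = (\<chi> j. frac (x j))"
    have "z = g y + (\<Sum>j\<in>UNIV. of_int \<lfloor>x j\<rfloor> *\<^sub>R v j)"
      unfolding x g_def y_def
      by (simp add: frac_def flip: sum.distrib scaleR_add_left)
    then have "w = f (g y)" using z periodic by metis
    moreover have "y \<in> cbox 0 1"
      by (auto simp: y_def mem_box_cart less_imp_le frac_lt_1)
    ultimately show "w \<in> f ` g ` cbox 0 1" by blast
  qed
  ultimately show ?thesis by (meson bounded_subset compact_imp_bounded)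
qed

text \<open>Liouville's theorem in one variable, applied on the complex line through 0 and
  \<open>z\<close>; complex linearity of the derivative makes the restriction holomorphic.\<close>

lemma holomorphic_C2_bounded_imp_constant:
  assumes "holomorphic_C2 f" "bounded (range f)"
  shows "f z = f 0"
proof -
  define h where "h t = f (t *s z)" for t
  have "\<exists>D'. (h has_field_derivative D') (at t)" for t
  proof -
    obtain D where D: "(f has_derivative D) (at (t *s z))" "Vector_Spaces.linear (*s) (*) D"
      using assms(1) unfolding holomorphic_C2_def by blast
    have "bounded_linear (\<lambda>t::complex. t *s z)"
      unfolding linear_conv_bounded_linear[symmetric]
      by (rule linearI) (simp_all add: vec_eq_iff algebra_simps)
    then have "((\<lambda>t. t *s z) has_derivative (\<lambda>t. t *s z)) (at t)"
      by (rule bounded_linear_imp_has_derivative)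
    from diff_chain_at[OF this D(1)]
    have "(h has_derivative (\<lambda>s. D (s *s z))) (at t)"
      by (simp add: h_def[abs_def] o_def)
    moreover have "(\<lambda>s. D (s *s z)) = (*) (D z)"
      using D(2) by (auto simp: Vector_Spaces.linear_iff mult.commute)
    ultimately show ?thesis by (auto simp: has_field_derivative_def)
  qed
  then have "h holomorphic_on UNIV"
    by (auto simp: holomorphic_on_def field_differentiable_def intro: has_field_derivative_at_within)
  moreover have "bounded (range h)"
    using assms(2) by (rule bounded_subset) (auto simp: h_def)
  ultimately have "h constant_on UNIV" by (rule Liouville_theorem)
  then have "h 1 = h 0" by (auto simp: constant_on_def)
  then show ?thesis by (simp add: h_def)
qed

context symplectic_frame
begin

definition dual_form :: "2 \<Rightarrow> form" where
  "dual_form i z u = (dual_matrix *v u) $ i"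

lemma period_dual_form: "period (dual_form i) l = (dual_matrix *v l) $ i"
  by (simp add: period_def dual_form_def)

lemma dual_form_Inr: "dual_form i z (v (Inr j)) = (if i = j then 1 else 0)"
  unfolding dual_form_def v_Inr dual_matrix_left by (auto simp: axis_def)

lemma dual_form_expansion: "u = dual_form 1 z u *s v (Inr 1) + dual_form 2 z u *s v (Inr 2)"
  using dual_matrix_right[of u] by (simp add: frame_matrix_mult dual_form_def)

text \<open>On a fixed tangent vector the form is an entire, lattice-periodic and hence bounded
  function.\<close>

lemma holomorphic_1_form_constant:
  assumes L: "range (int_comb v) = L" and \<eta>: "\<eta> \<in> holomorphic_1_forms L"
  shows "\<eta> z = \<eta> 0"
proof
  fix u
  have hol: "holomorphic_C2 (\<lambda>z. \<eta> z u)" and per: "\<And>l z. l \<in> L \<Longrightarrow> \<eta> (z + l) = \<eta> z"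
    using \<eta> by (auto simp: holomorphic_1_forms_def)
  have "bounded (range (\<lambda>z. \<eta> z u))"
  proof (rule bounded_if_lattice_periodic[where v = v])
    show "continuous_on UNIV (\<lambda>z. \<eta> z u)"
      using hol unfolding holomorphic_C2_def
      by (intro continuous_at_imp_continuous_on) (blast intro: has_derivative_continuous)
    show "\<exists>x. z = (\<Sum>j\<in>UNIV. x j *\<^sub>R v j)" for z
      by (rule exI[of _ "case_sum (\<lambda>i. Im (H z (v (Inr i)))) (\<lambda>i. - Im (H z (v (Inl i))))"],
          subst frame_expansion[of z]) (simp add: sum_2_plus_2)
    show "\<eta> (z + (\<Sum>j\<in>UNIV. of_int (n j) *\<^sub>R v j)) u = \<eta> z u" for z n
    proof -
      have "(\<Sum>j\<in>UNIV. of_int (n j) *\<^sub>R v j) = int_comb v (\<chi> j. n j)"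
        by (simp add: int_comb_def)
      then show ?thesis using per L by (metis rangeI)
    qed
  qed
  with hol show "\<eta> z u = \<eta> 0 u" by (rule holomorphic_C2_bounded_imp_constant)
qed

lemma basis_of_1_forms_dual_form:
  assumes L: "range (int_comb v) = L"
  shows "basis_of_1_forms L dual_form"
  unfolding basis_of_1_forms_def
proof (intro conjI allI ballI)
  show "dual_form i \<in> holomorphic_1_forms L" for i
  proof -
    have "Vector_Spaces.linear (*s) (*) (dual_form i z)" for z
      by (simp add: Vector_Spaces.linear_iff dual_form_def matrix_vector_right_distrib
          vector_scalar_commute vec.vector_space_axioms vector_space_over_itself.vector_space_axioms)
    moreover have "holomorphic_C2 (\<lambda>z. dual_form i z u)" for u
      unfolding holomorphic_C2_def dual_form_def
      by (intro allI exI[of _ "\<lambda>_. 0"])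
        (simp add: Vector_Spaces.linear_iff vec.vector_space_axioms
          vector_space_over_itself.vector_space_axioms)
    moreover have "dual_form i (z + l) = dual_form i z" for z l
      by (simp add: dual_form_def fun_eq_iff)
    ultimately show ?thesis by (simp add: holomorphic_1_forms_def)
  qed
next
  fix \<eta> assume \<eta>: "\<eta> \<in> holomorphic_1_forms L"
  then have lin: "Vector_Spaces.linear (*s) (*) (\<eta> 0)"
    by (simp add: holomorphic_1_forms_def)
  show "\<exists>!c :: complex^2. \<eta> = (\<lambda>z u. \<Sum>i\<in>UNIV. c $ i * dual_form i z u)"
  proof (rule ex1I)
    let ?c = "\<chi> i. \<eta> 0 (v (Inr i))"
    have "\<eta> z u = (\<Sum>i\<in>UNIV. ?c $ i * dual_form i z u)" for z u
    proof -
      have "\<eta> z u = \<eta> 0 u" using holomorphic_1_form_constant[OF L \<eta>] by metis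
      also have "\<dots> = \<eta> 0 (dual_form 1 z u *s v (Inr 1) + dual_form 2 z u *s v (Inr 2))"
        by (subst dual_form_expansion[of u z]) simp
      also have "\<dots> = (\<Sum>i\<in>UNIV. ?c $ i * dual_form i z u)"
        using lin by (simp add: Vector_Spaces.linear_iff sum_2 mult.commute)
      finally show ?thesis .
    qed
    then show "\<eta> = (\<lambda>z u. \<Sum>i\<in>UNIV. ?c $ i * dual_form i z u)" by blast
  next
    fix c :: "complex^2" assume c: "\<eta> = (\<lambda>z u. \<Sum>i\<in>UNIV. c $ i * dual_form i z u)"
    show "c = (\<chi> i. \<eta> 0 (v (Inr i)))"
      unfolding c by (simp add: vec_eq_iff forall_2 sum_2 dual_form_Inr)
  qed
qed

end

subsection \<open>Period matrices\<close>

lemma phi_eq: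
  "phi d (z, r) = (if d mod 4 = 1
    then vector [vector [4 * z, 2 * of_real r - 2 * z],
      vector [2 * of_real r - 2 * z, z - 2 * of_real r + of_int d * cnj z]]
    else vector [vector [z, of_real r], vector [of_real r, of_int d * cnj z]])"
  by (simp add: phi_def sigma_mat_def Let_def vec_eq_iff forall_2 sum_2 matrix_matrix_mult_def
      transpose_def mat_def algebra_simps)

text \<open>In the coordinates y = (transpose of \<open>sigma_mat d\<close>) x the imaginary part is
  the diagonal form Im z (y_1^2 - d y_2^2), definite for negative \<open>d\<close>.\<close>

lemma phi_in_siegel_space:
  assumes "d < 0" "Im z > 0"
  shows "phi d (z, r) \<in> siegel_space"
proof -
  have "x \<bullet> (map_matrix Im (phi d (z, r)) *v x) > 0" if "x \<noteq> 0" for x :: "real^2"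
  proof -
    have "x $ 1 \<noteq> 0 \<or> x $ 2 \<noteq> 0"
      using that by (simp add: vec_eq_iff forall_2)
    moreover have "a\<^sup>2 + (- of_int d) * b\<^sup>2 > 0" if "a \<noteq> 0 \<or> b \<noteq> 0" for a b :: real
    proof (cases "b = 0")
      case False
      then have "(- of_int d) * b\<^sup>2 > 0" using assms(1) by (intro mult_pos_pos) auto
      then show ?thesis by (intro add_nonneg_pos) auto
    qed (use that in auto)
    ultimately have pos: "(x $ 1)\<^sup>2 + (- of_int d) * (x $ 2)\<^sup>2 > 0"
      "(2 * x $ 1 - x $ 2)\<^sup>2 + (- of_int d) * (x $ 2)\<^sup>2 > 0"
      by (metis, metis diff_zero mult_eq_0_iff zero_neq_numeral diff_0_right)
    have "x \<bullet> (map_matrix Im (phi d (z, r)) *v x) =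
      Im z * ((if d mod 4 = 1 then 2 * x $ 1 - x $ 2 else x $ 1)\<^sup>2 + (- of_int d) * (x $ 2)\<^sup>2)"
      by (simp add: phi_eq inner_vec_def matrix_vector_mult_def sum_2 power2_eq_square algebra_simps)
    then show ?thesis using pos assms(2) by simp
  qed
  moreover have "transpose (phi d (z, r)) = phi d (z, r)"
    by (simp add: phi_eq transpose_def vec_eq_iff forall_2)
  ultimately show ?thesis by (simp add: siegel_space_def)
qed

text \<open>The hypothesis \<open>row\<close> is the first column of beta conj(Z) = Z (transpose of
  beta). Together with symmetry it leaves one complex and one real parameter.\<close>

lemma in_phi_H3:
  assumes "Z $ 2 $ 1 = Z $ 1 $ 2" and "Im (Z $ 1 $ 1) > 0"
    and row: "\<And>i. of_int (beta_mat d $ i $ 1) * cnj (Z $ 1 $ 1) + of_int (beta_mat d $ i $ 2) * cnj (Z $ 2 $ 1)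
      = of_int (beta_mat d $ 1 $ 1) * Z $ i $ 1 + of_int (beta_mat d $ 1 $ 2) * Z $ i $ 2"
  shows "Z \<in> phi d ` H3"
proof (cases "d mod 4 = 1")
  case True
  define m where "m = (d - 1) div 4"
  have d: "d = 4 * m + 1" using True unfolding m_def by presburger
  \<comment> \<open>Solved from \<open>phi_eq\<close>: the first row 4 z, 2 r - 2 z gives Z_11 + 2
    Z_12 = 4 r, which is real by \<open>1\<close>.\<close>
  define r where "r = Re (Z $ 1 $ 1 + 2 * Z $ 1 $ 2) / 4"
  have 1: "cnj (Z $ 1 $ 1) + 2 * cnj (Z $ 1 $ 2) = Z $ 1 $ 1 + 2 * Z $ 1 $ 2"
    using row[of 1] True assms(1) by (simp add: beta_mat_def)
  have 2: "2 * of_int m * cnj (Z $ 1 $ 1) - cnj (Z $ 1 $ 2) = Z $ 1 $ 2 + 2 * Z $ 2 $ 2"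
    using row[of 2] True assms(1) by (simp add: beta_mat_def m_def)
  have "Z = phi d (Z $ 1 $ 1 / 4, r)"
    using 1 2 True assms(1)
    by (simp add: phi_eq vec_eq_iff forall_2 r_def complex_eq_iff d field_simps)
  then show ?thesis using assms(2) by (auto simp: H3_def)
next
  case False
  have "Z $ 1 $ 2 = cnj (Z $ 1 $ 2)" "of_int d * cnj (Z $ 1 $ 1) = Z $ 2 $ 2"
    using row[of 1] row[of 2] False assms(1) by (simp_all add: beta_mat_def)
  then have "Z = phi d (Z $ 1 $ 1, Re (Z $ 1 $ 2))"
    using False assms(1) by (simp add: phi_eq vec_eq_iff forall_2 complex_eq_iff)
  then show ?thesis using assms(2) by (auto simp: H3_def)
qed

context symplectic_frame
begin

definition normal_period :: "complex^2^2" where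
  "normal_period = (\<chi> i j. (dual_matrix *v v (Inl j)) $ i)"

lemma period_matrix_dual_form: "period_matrix dual_form v = hcat normal_period (mat 1)"
  unfolding period_matrix_def period_dual_form hcat_def normal_period_def
  by (simp add: vec_eq_iff split_sum_all v_Inr dual_matrix_left mat_def axis_def)

lemma v_Inl: "v (Inl j) = normal_period $ 1 $ j *s v (Inr 1) + normal_period $ 2 $ j *s v (Inr 2)"
  using dual_matrix_right[of "v (Inl j)"] by (simp add: frame_matrix_mult normal_period_def)

lemma frame_coordinates_unique:
  assumes "a *s v (Inr 1) + b *s v (Inr 2) = a' *s v (Inr 1) + b' *s v (Inr 2)"
  shows "a = a'" and "b = b'"
proof -
  have "(vector [a, b] :: complex^2) = vector [a', b']"
    by (rule frame_matrix_cancel) (simp add: frame_matrix_mult assms)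
  then show "a = a'" "b = b'" by (simp_all add: vec_eq_iff forall_2)
qed

text \<open>The Gram matrix \<open>h\<close> of \<open>H\<close> on the \<open>v (Inr i)\<close> is
  real and symmetric. The mixed symplectic relations say that Im Z is inverse to \<open>h\<close>,
  hence symmetric and positive; the relation between \<open>v (Inl 1)\<close> and
  \<open>v (Inl 2)\<close> makes Re Z symmetric.\<close>

lemma riemann_relations:
  shows normal_period_symmetric: "normal_period $ 2 $ 1 = normal_period $ 1 $ 2"
    and Im_normal_period_pos: "Im (normal_period $ 1 $ 1) > 0"
proof -
  define h where "h i k = Re (H (v (Inr i)) (v (Inr k)))" for i k :: 2
  have h: "H (v (Inr i)) (v (Inr k)) = of_real (h i k)" for i k
    by (simp add: h_def complex_eq_iff symplectic)
  have h21: "h 2 1 = h 1 2"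
    using H_cnj[of "v (Inr 2)" "v (Inr 1)"] by (simp add: h_def)
  define x y where "x i j = Re (normal_period $ i $ j)" and "y i j = Im (normal_period $ i $ j)"
    for i j :: 2
  have dual: "y 1 j * h 1 k + y 2 j * h 2 k = (if j = k then 1 else 0)" for j k
    using symplectic[of "Inl j" "Inr k"]
    by (subst (asm) v_Inl) (simp add: H_simps h y_def)
  have y11: "y 1 1 * h 1 1 + y 2 1 * h 1 2 = 1" and y12: "y 1 1 * h 1 2 + y 2 1 * h 2 2 = 0"
    and y21: "y 1 2 * h 1 1 + y 2 2 * h 1 2 = 0" and y22: "y 1 2 * h 1 2 + y 2 2 * h 2 2 = 1"
    using dual[of 1 1] dual[of 1 2] dual[of 2 1] dual[of 2 2] by (simp_all add: h21)
  \<comment> \<open>Symmetry of the inverse of \<open>h\<close>, written out: all terms except those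
    in \<open>h 1 2\<close> cancel.\<close>
  have "y 2 1 = y 2 1 * (y 1 2 * h 1 2 + y 2 2 * h 2 2) - y 2 2 * (y 1 1 * h 1 2 + y 2 1 * h 2 2)"
    by (simp add: y12 y22)
  also have "\<dots> = y 1 2 * (y 1 1 * h 1 1 + y 2 1 * h 1 2) - y 1 1 * (y 1 2 * h 1 1 + y 2 2 * h 1 2)"
    by (simp add: algebra_simps)
  also have "\<dots> = y 1 2" by (simp add: y11 y21)
  finally have y_sym: "y 2 1 = y 1 2" .
  have "Im (H (v (Inl 1)) (v (Inl 2))) = 0" by (simp add: symplectic)
  then have "x 1 2 * (y 1 1 * h 1 1 + y 2 1 * h 1 2) + x 2 2 * (y 1 1 * h 1 2 + y 2 1 * h 2 2)
      - x 1 1 * (y 1 2 * h 1 1 + y 2 2 * h 1 2) - x 2 1 * (y 1 2 * h 1 2 + y 2 2 * h 2 2) = 0"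
    unfolding v_Inl by (simp add: H_simps h h21 x_def y_def algebra_simps)
  then have x_sym: "x 2 1 = x 1 2" by (simp add: y11 y12 y21 y22)
  show "normal_period $ 2 $ 1 = normal_period $ 1 $ 2"
    using x_sym y_sym by (simp add: x_def y_def complex_eq_iff)
  \<comment> \<open>The coefficients are the first column of Im Z, so that \<open>H w w\<close> is
    the diagonal entry \<open>y 1 1\<close>.\<close>
  define w where "w = of_real (y 1 1) *s v (Inr 1) + of_real (y 2 1) *s v (Inr 2)"
  have "H w (v (Inr 1)) = 1"
    using y11 by (simp add: w_def H_simps h h21 flip: of_real_mult of_real_add)
  then have "w \<noteq> 0" using H_smult_left[of 0 0 "v (Inr 1)"] by auto
  have "Re (H w w) = y 1 1 * (y 1 1 * h 1 1 + y 2 1 * h 1 2) + y 2 1 * (y 1 1 * h 1 2 + y 2 1 * h 2 2)"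
    by (simp add: w_def H_simps h h21 algebra_simps)
  also have "\<dots> = y 1 1" by (simp add: y11 y12)
  finally show "Im (normal_period $ 1 $ 1) > 0"
    using H_pos[OF \<open>w \<noteq> 0\<close>] by (simp add: y_def)
qed

section \<open>The matrix of \<open>\<kappa>\<close> and its constraint on the periods\<close>

lemma N_beta_nth [simp]:
  "N_beta d $ Inl i $ Inl j = beta_mat d $ i $ j" "N_beta d $ Inl i $ Inr j = 0"
  "N_beta d $ Inr i $ Inl j = 0" "N_beta d $ Inr i $ Inr j = beta_mat d $ j $ i"
  by (simp_all add: N_beta_def transpose_def)

lemma has_matrix_transpose_N_beta:
  "has_matrix v \<kappa> (transpose (N_beta d)) \<longleftrightarrow> (\<forall>i.
    \<kappa> (v (Inl i)) = of_int (beta_mat d $ i $ 1) *s v (Inl 1) + of_int (beta_mat d $ i $ 2) *s v (Inl 2) \<and>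
    \<kappa> (v (Inr i)) = of_int (beta_mat d $ 1 $ i) *s v (Inr 1) + of_int (beta_mat d $ 2 $ i) *s v (Inr 2))"
  by (auto simp: has_matrix_def split_sum_all int_comb_2_plus_2 column_transpose row_def
      scaleR_eq_vector_smult)

text \<open>Computing \<open>\<kappa> (v (Inl 1))\<close> from its complex coordinates, which
  antilinearity conjugates, and from the matrix gives two expressions in the complex basis
  \<open>v (Inr 1)\<close>, \<open>v (Inr 2)\<close>.\<close>

lemma normal_period_in_phi_H3:
  assumes "antilinear \<kappa>" and matrix: "has_matrix v \<kappa> (transpose (N_beta d))"
  shows "normal_period \<in> phi d ` H3"
proof (rule in_phi_H3)
  let ?Z = normal_period and ?\<beta> = "\<lambda>i j. of_int (beta_mat d $ i $ j) :: complex"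
  note \<kappa> = matrix[unfolded has_matrix_transpose_N_beta, rule_format]
  have "(?\<beta> 1 1 * cnj (?Z $ 1 $ 1) + ?\<beta> 1 2 * cnj (?Z $ 2 $ 1)) *s v (Inr 1)
      + (?\<beta> 2 1 * cnj (?Z $ 1 $ 1) + ?\<beta> 2 2 * cnj (?Z $ 2 $ 1)) *s v (Inr 2)
    = cnj (?Z $ 1 $ 1) *s \<kappa> (v (Inr 1)) + cnj (?Z $ 2 $ 1) *s \<kappa> (v (Inr 2))"
    unfolding \<kappa>[THEN conjunct2] by (simp add: vec_eq_iff algebra_simps)
  also have "\<dots> = \<kappa> (v (Inl 1))"
    unfolding v_Inl[of 1] using assms(1) by (simp add: antilinear_def)
  also have "\<dots> = (?\<beta> 1 1 * ?Z $ 1 $ 1 + ?\<beta> 1 2 * ?Z $ 1 $ 2) *s v (Inr 1)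
      + (?\<beta> 1 1 * ?Z $ 2 $ 1 + ?\<beta> 1 2 * ?Z $ 2 $ 2) *s v (Inr 2)"
    unfolding \<kappa>[of 1, THEN conjunct1] unfolding v_Inl by (simp add: vec_eq_iff algebra_simps)
  finally show "?\<beta> i 1 * cnj (?Z $ 1 $ 1) + ?\<beta> i 2 * cnj (?Z $ 2 $ 1)
      = ?\<beta> 1 1 * ?Z $ i $ 1 + ?\<beta> 1 2 * ?Z $ i $ 2" for i
    using frame_coordinates_unique exhaust_2[of i] by blast
qed (fact riemann_relations)+

end

text \<open>The symplectic basis supplied by the principal polarization yields both integrality of
  \<open>Q\<close> on \<open>L\<close> and self-duality.\<close>

lemma quadratic_lattice_surface:
  assumes "d < 0" "pp_abelian_surface L H" "antiholomorphic_multiplication d L H \<kappa>"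
  shows "quadratic_lattice d \<kappa> (\<lambda>u v. Im (H u v)) L"
proof -
  obtain f where "pos_def_hermitian H" and f: "symplectic_basis L H f"
    and L: "0 \<in> L" "\<And>u v. u \<in> L \<Longrightarrow> v \<in> L \<Longrightarrow> u - v \<in> L"
    using assms(2) by (auto simp: pp_abelian_surface_def is_lattice_def)
  interpret symplectic_frame H f
    using \<open>pos_def_hermitian H\<close> f by unfold_locales (auto simp: symplectic_basis_def)
  have range: "range (int_comb f) = L" using f by (simp add: symplectic_basis_iff)
  have f_in: "f j \<in> L" for j
    using f Z_basis_mem by (auto simp: symplectic_basis_def)
  have "antilinear \<kappa>" and 1: "\<And>u. \<kappa> (\<kappa> u) = of_int d *s u"
    and 2: "\<And>u v. Im (H (\<kappa> u) (\<kappa> v)) = of_int d * Im (H u v)"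
    and 3: "\<kappa> ` L \<subseteq> L" and 4: "d mod 4 = 1 \<Longrightarrow> (\<lambda>u. (1/2) *s (\<kappa> u + u)) ` L \<subseteq> L"
    using assms(3) unfolding antiholomorphic_multiplication_def by blast+
  show ?thesis
  proof (intro quadratic_lattice.intro quadratic_action.intro quadratic_lattice_axioms.intro)
    show "linear \<kappa>"
      using \<open>antilinear \<kappa>\<close> by (intro linearI) (auto simp: antilinear_def scaleR_eq_vector_smult)
    show "\<kappa> (\<kappa> u) = of_int d *\<^sub>R u" for u
      by (simp add: 1 scaleR_eq_vector_smult)
    show "(1/2) *\<^sub>R (\<kappa> u + u) \<in> L" if "d mod 4 = 1" "u \<in> L" for u
      using 4 that by (auto simp: scaleR_eq_vector_smult image_subset_iff)
    show "Im (H u w) \<in> \<int>" if uw: "u \<in> L" "w \<in> L" for u w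
    proof -
      obtain m n where "u = int_comb f m" "w = int_comb f n"
        using uw range by blast
      then show ?thesis
        by (simp add: int_comb_2_plus_2 Im_H_simps symplectic)
    qed
    show "u \<in> L" if "\<And>w. w \<in> L \<Longrightarrow> Im (H u w) \<in> \<int>" for u
      using int_comb_if_integral[of u] that f_in range by blast
  qed (use assms(1) 2 3 L in \<open>auto intro: bilinear_Im_H Im_H_skew\<close>)
qed

theorem proposition5p5:
  fixes d :: int
    and L :: "(complex^2) set"
    and H :: "complex^2 \<Rightarrow> complex^2 \<Rightarrow> complex"
    and \<kappa> :: "complex^2 \<Rightarrow> complex^2"
  assumes "d < 0" and "squarefree d"
    and "principal_domain (ring_of_integers d)"
    and "pp_abelian_surface L H"
    and "antiholomorphic_multiplication d L H \<kappa>"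
  shows "phi d ` H3 \<subseteq> siegel_space \<and>
    (\<exists>\<omega> v Z. basis_of_1_forms L \<omega> \<and> symplectic_basis L H v \<and>
       period_matrix \<omega> v = hcat Z (mat 1) \<and> Z \<in> phi d ` H3 \<and>
       has_matrix v \<kappa> (transpose (N_beta d)))"
proof (intro conjI)
  show "phi d ` H3 \<subseteq> siegel_space"
    using phi_in_siegel_space[OF assms(1)] by (auto simp: H3_def)
  interpret quadratic_lattice d \<kappa> "\<lambda>u v. Im (H u v)" L
    by (rule quadratic_lattice_surface[OF assms(1,4,5)])
  have H: "pos_def_hermitian H" using assms(4) by (simp add: pp_abelian_surface_def)
  have \<kappa>: "antilinear \<kappa>" using assms(5) by (simp add: antiholomorphic_multiplication_def)
  obtain f where f: "symplectic_basis L H f"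
    using assms(4) by (auto simp: pp_abelian_surface_def)
  \<comment> \<open>The first symplectic pair has \<open>Q\<close>-value 1, which makes the ideal of
    pairing values nonzero.\<close>
  then have "f (Inl 1) \<in> L" "f (Inr 1) \<in> L" "Im (H (f (Inl 1)) (f (Inr 1))) \<noteq> 0"
    by (auto simp: symplectic_basis_def Z_basis_mem)
  then obtain p q where pq: "p \<in> L" "q \<in> L" "Im (H p q) = 0" "Im (H p (\<kappa> q)) = scale"
    using exists_normalized_pair[OF assms(2,3)] by blast
  define t where "t = scale - 1"
  \<comment> \<open>The opposite signs of \<open>t\<close> make \<open>v (Inl 2)\<close> and
    \<open>v (Inr 1)\<close> orthogonal for \<open>Q\<close>; for \<open>t = 1\<close> both are
    half-integral multiples that stay in \<open>L\<close>.\<close>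
  define v :: "2 + 2 \<Rightarrow> complex^2" where
    "v = case_sum (\<lambda>i. if i = 1 then p else (1 / scale) *\<^sub>R (\<kappa> p - t *\<^sub>R p))
      (\<lambda>i. if i = 1 then (1 / scale) *\<^sub>R (\<kappa> q + t *\<^sub>R q) else q)"
  have v: "v (Inl 1) = p" "v (Inl 2) = (1 / scale) *\<^sub>R (\<kappa> p - t *\<^sub>R p)"
    "v (Inr 1) = (1 / scale) *\<^sub>R (\<kappa> q + t *\<^sub>R q)" "v (Inr 2) = q"
    by (simp_all add: v_def)
  have half_minus: "(1/2) *\<^sub>R (\<kappa> p - p) \<in> L" if "d mod 4 = 1"
  proof -
    have "(1/2) *\<^sub>R (\<kappa> p - p) = (1/2) *\<^sub>R (\<kappa> p + p) - p"
      by (simp add: vec_eq_iff complex_eq_iff field_simps)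
    then show ?thesis using half_in_L[OF that pq(1)] pq(1) diff_in_L by metis
  qed
  have v_in_L: "v j \<in> L" for j
  proof -
    have "v (Inl 2) \<in> L" "v (Inr 1) \<in> L"
      using half_minus half_in_L kappa_in_L pq(1,2) by (auto simp: v scale_def t_def)
    then have "\<forall>j. v j \<in> L" by (simp add: forall_2_plus_2 v pq)
    then show ?thesis ..
  qed
  have "Im (H (\<kappa> p) q) = scale" "Im (H (\<kappa> p) (\<kappa> q)) = 0"
    using pq by (simp add: Q_kappa_left, simp add: Q_kappa_kappa)
  moreover from this have "Im (H q p) = 0" "Im (H (\<kappa> q) p) = - scale" "Im (H q (\<kappa> p)) = - scale"
    "Im (H (\<kappa> q) (\<kappa> p)) = 0"
    using pq(3,4) Q_skew[of q p] Q_skew[of "\<kappa> q" p] Q_skew[of q "\<kappa> p"] Q_skew[of "\<kappa> q" "\<kappa> p"]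
    by simp_all
  moreover have "Im (H (\<kappa> u) u) = 0" for u
    by (simp add: Q_kappa_left Q_self_kappa)
  ultimately have "\<forall>j k. Im (H (v j) (v k)) = of_int (symplectic_matrix $ j $ k)"
    using pq(3,4) scale_pos
    by (simp add: forall_2_plus_2 v Q_simps Q_self Q_self_kappa field_simps)
  then interpret frame: symplectic_frame H v
    using H by unfold_locales auto
  have range: "range (int_comb v) = L"
  proof
    show "range (int_comb v) \<subseteq> L"
      by (auto simp: int_comb_2_plus_2 intro!: add_in_L of_int_scale_in_L v_in_L)
    \<comment> \<open>Unimodularity: a lattice vector has integral \<open>Q\<close>-values against
      the new family, hence integral coordinates.\<close>
    show "L \<subseteq> range (int_comb v)"
      using frame.int_comb_if_integral Q_int v_in_L by blast
  qed
  have matrix: "has_matrix v \<kappa> (transpose (N_beta d))"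
  proof (cases "d mod 4 = 1")
    case True
    define m where "m = (d - 1) div 4"
    have "d = 4 * m + 1" using True unfolding m_def by presburger
    then have d: "real_of_int d = 4 * of_int m + 1" by simp
    show ?thesis
      using True unfolding frame.has_matrix_transpose_N_beta
      by (simp add: forall_2 v scale_def t_def beta_mat_def kappa_simps kappa_kappa d flip: m_def)
        (simp add: vec_eq_iff complex_eq_iff field_simps)
  next
    case False
    then show ?thesis
      unfolding frame.has_matrix_transpose_N_beta
      by (simp add: forall_2 v scale_def t_def beta_mat_def kappa_simps kappa_kappa
          scaleR_eq_vector_smult)
  qed
  have "symplectic_basis L H v" using range by (simp add: frame.symplectic_basis_iff)
  with frame.basis_of_1_forms_dual_form[OF range] frame.period_matrix_dual_form
    frame.normal_period_in_phi_H3[OF \<kappa> matrix] matrix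
  show "\<exists>\<omega> v Z. basis_of_1_forms L \<omega> \<and> symplectic_basis L H v \<and>
      period_matrix \<omega> v = hcat Z (mat 1) \<and> Z \<in> phi d ` H3 \<and>
      has_matrix v \<kappa> (transpose (N_beta d))"
    by blast
qed

end
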